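(* Let $A\in\mathbb{R}_+^{n\times n}$ be an irreducible nonnegative matrix whose associated digraph contains at least one cycle, and let $\alpha(A)$ be the set of positive numbers $a$ for which an $a$-sum visualization of $A$ exists. Then $\alpha(A)=[\mu(A),\rho(A)]$.
   Context: $\mathbb{R}_+$ denotes the nonnegative reals; $\rho(A)$ is the spectral radius (Perron root) of $A$. The associated digraph of $A=(a_{ij})$ has nodes $\{1,\dots,n\}$ and an edge $(i,j)$ exactly when $a_{ij}\neq0$ (loops allowed); $A$ is irreducible if this digraph is strongly connected. $\mu(A)$ is the maximum, over all cycles $(i_1,\dots,i_\ell)$ of the digraph, of $(a_{i_1i_2}a_{i_2i_3}\cdots a_{i_\ell i_1})^{1/\ell}$. For $a>0$, a vector $x$ with positive entries is an $a$-sum visualizing vector of $A$ if the entries of $C=X^{-1}AX$, with $X=\operatorname{diag}(x)$, satisfy $c_{ij}\le a$ for all $i,j$ and $\sum_j c_{ij}\ge a$ for all $i$. In this case $C$ is called an $a$-sum visualization of $A$. *)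

theory Defs
  imports
    "HOL-Analysis.Analysis"
    "Graph_Theory.Graph_Theory"
    "Jordan_Normal_Form.Spectral_Radius"
begin

text \<open>
  Square matrices are those of \<open>Jordan_Normal_Form.Matrix\<close>; the index set is
  \<open>{0, ..., n - 1}\<close> rather than \<open>{1, ..., n}\<close>.
\<close>

definition nonneg_real_mat :: "real mat \<Rightarrow> bool" where
  "nonneg_real_mat A \<longleftrightarrow> (\<forall>i < dim_row A. \<forall>j < dim_col A. 0 \<le> A $$ (i, j))"

definition mat_digraph :: "real mat \<Rightarrow> (nat, nat \<times> nat) pre_digraph" where
  "mat_digraph A = with_proj
     \<lparr> pverts = {0..<dim_row A},
       parcs = {(i, j). i < dim_row A \<and> j < dim_col A \<and> A $$ (i, j) \<noteq> 0} \<rparr>"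

text \<open>
  \<open>strongly_connected\<close> requires a nonempty vertex set and uses reflexive reachability:
  an irreducible matrix has positive dimension, and every \<open>1 \<times> 1\<close> matrix, including
  the zero matrix, is irreducible.
\<close>
definition irreducible_real_mat :: "real mat \<Rightarrow> bool" where
  "irreducible_real_mat A \<longleftrightarrow> strongly_connected (mat_digraph A)"

text \<open>
  A cycle \<open>(i\<^sub>1, ..., i\<^sub>l)\<close> is represented, as in \<open>Graph_Theory\<close>, by its arc list
  \<open>[(i\<^sub>1, i\<^sub>2), ..., (i\<^sub>l, i\<^sub>1)]\<close>; its nodes are distinct, and loops are cycles of length 1.
\<close>
definition mat_cycles :: "real mat \<Rightarrow> (nat \<times> nat) list set" where
  "mat_cycles A = {p. pre_digraph.cycle (mat_digraph A) p}"

definition cycle_geometric_mean :: "real mat \<Rightarrow> (nat \<times> nat) list \<Rightarrow> real" where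
  "cycle_geometric_mean A p = root (length p) (\<Prod>e\<leftarrow>p. A $$ e)"

text \<open>Meaningful only if there is at least one cycle, since \<open>Max {}\<close> is unspecified.\<close>
definition max_cycle_mean :: "real mat \<Rightarrow> real" where
  "max_cycle_mean A = Max (cycle_geometric_mean A ` mat_cycles A)"

lemma finite_mat_cycles:
  assumes "A \<in> carrier_mat n n"
  shows "finite (mat_cycles A)"
proof -
  interpret wf_digraph "mat_digraph A"
    using assms by unfold_locales (auto simp: mat_digraph_def)
  have "arcs (mat_digraph A) \<subseteq> {0..<n} \<times> {0..<n}"
    using assms by (auto simp: mat_digraph_def)
  then have "mat_cycles A \<subseteq> {p. set p \<subseteq> {0..<n} \<times> {0..<n} \<and> distinct p}"
    by (auto simp: mat_cycles_def cycle_conv awalk_def)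
  then show ?thesis
    by (rule finite_subset) (simp add: finite_subset_distinct)
qed

text \<open>\<open>X\<inverse> A X\<close> for \<open>X = diag(x)\<close>.\<close>
definition diag_similarity :: "real mat \<Rightarrow> real vec \<Rightarrow> real mat" where
  "diag_similarity A x =
     mat_diag (dim_vec x) (\<lambda>i. inverse (x $ i)) * A * mat_diag (dim_vec x) (\<lambda>i. x $ i)"

lemma inverts_mat_diag:
  fixes x :: "real vec"
  assumes "\<And>i. i < n \<Longrightarrow> x $ i \<noteq> 0"
  shows "inverts_mat (mat_diag n (\<lambda>i. x $ i)) (mat_diag n (\<lambda>i. inverse (x $ i)))"
    and "inverts_mat (mat_diag n (\<lambda>i. inverse (x $ i))) (mat_diag n (\<lambda>i. x $ i))"
  using assms
  by (auto simp: inverts_mat_def mat_diag_mult_left[OF mat_diag_dim] intro!: eq_matI)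
     (auto simp: mat_diag_def)

lemma diag_similarity_index:
  assumes "A \<in> carrier_mat n n" "x \<in> carrier_vec n" "i < n" "j < n"
  shows "diag_similarity A x $$ (i, j) = inverse (x $ i) * A $$ (i, j) * x $ j"
proof -
  have "mat_diag n (\<lambda>i. inverse (x $ i)) * A \<in> carrier_mat n n"
    by (rule mult_carrier_mat[OF mat_diag_dim assms(1)])
  then show ?thesis
    using assms
    by (simp add: diag_similarity_def mat_diag_mult_right[where nr = n]
        mat_diag_mult_left[where nr = n])
qed

definition sum_visualizing_vector :: "real \<Rightarrow> real mat \<Rightarrow> real vec \<Rightarrow> bool" where
  "sum_visualizing_vector a A x \<longleftrightarrow>
     a > 0 \<and> x \<in> carrier_vec (dim_row A) \<and> (\<forall>i < dim_row A. 0 < x $ i) \<and>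
     (\<forall>i < dim_row A. \<forall>j < dim_col A. diag_similarity A x $$ (i, j) \<le> a) \<and>
     (\<forall>i < dim_row A. a \<le> (\<Sum>j < dim_col A. diag_similarity A x $$ (i, j)))"

definition sum_visualization :: "real \<Rightarrow> real mat \<Rightarrow> real mat \<Rightarrow> bool" where
  "sum_visualization a A C \<longleftrightarrow>
     (\<exists>x. sum_visualizing_vector a A x \<and> C = diag_similarity A x)"

definition sum_visualization_levels :: "real mat \<Rightarrow> real set" where
  "sum_visualization_levels A = {a. a > 0 \<and> (\<exists>C. sum_visualization a A C)}"

definition real_spectral_radius :: "real mat \<Rightarrow> real" where
  "real_spectral_radius A = spectral_radius (map_mat complex_of_real A)"

end

theory Submission
  imports Defs
begin

text \<open>
  If \<open>C = X\<inverse> A X\<close> is an \<open>a\<close>-sum visualization, cycle products of \<open>A\<close> and \<open>C\<close> agree, so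
  \<open>\<mu>(A) \<le> a\<close>, and \<open>A x \<ge> a x\<close> with \<open>x > 0\<close> makes the powers of \<open>A / b\<close> unbounded for every
  \<open>b < a\<close>, so \<open>a \<le> \<rho>(A)\<close>.

  Conversely let \<open>\<mu>(A) \<le> a \<le> \<rho>(A)\<close> and \<open>B = A / a\<close>. The suprema of walk weights give a positive
  \<open>x\<^sub>0\<close> with \<open>b\<^sub>i\<^sub>j x\<^sub>0\<^sub>j \<le> x\<^sub>0\<^sub>i\<close>, and the absolute values of an eigenvector for an eigenvalue of
  maximal modulus give \<open>u \<ge> 0\<close>, \<open>u \<noteq> 0\<close> with \<open>u \<le> B u\<close>; rescale so that \<open>u \<le> x\<^sub>0\<close>.
  The greatest \<open>x \<ge> u\<close> with \<open>x = min x\<^sub>0 (B x)\<close> then satisfies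
  \<open>max\<^sub>j b\<^sub>i\<^sub>j x\<^sub>j \<le> x\<^sub>i \<le> \<Sum>\<^sub>j b\<^sub>i\<^sub>j x\<^sub>j\<close>, and irreducibility makes it positive.
\<close>

section \<open>Weights of walks\<close>

context wf_digraph
begin

lemma awalk_prod_nonneg:
  fixes w :: "'b \<Rightarrow> 'c::linordered_semidom"
  assumes "\<And>e. e \<in> arcs G \<Longrightarrow> 0 \<le> w e" and "awalk u p v"
  shows "0 \<le> (\<Prod>e\<leftarrow>p. w e)"
  using assms by (intro prod_list_nonneg) (auto simp: awalk_def)

lemma awalk_prod_pos:
  fixes w :: "'b \<Rightarrow> 'c::linordered_semidom"
  assumes "\<And>e. e \<in> arcs G \<Longrightarrow> 0 < w e" and "awalk u p v"
  shows "0 < (\<Prod>e\<leftarrow>p. w e)"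
  using assms(2)
  by (induction p arbitrary: u) (auto simp: awalk_Cons_iff assms(1))

text \<open>Multiplying the arc inequalities along the walk telescopes: every arc contributes a
  factor \<open>a\<close>. It serves twice: on cycles, to bound their means by \<open>a\<close>, and
  with \<open>a = 1\<close>, to carry positivity backwards along a walk.\<close>

lemma awalk_prod_le_potential:
  fixes w :: "'b \<Rightarrow> real"
  assumes w: "\<And>e. e \<in> arcs G \<Longrightarrow> 0 \<le> w e"
    and x: "\<And>e. e \<in> arcs G \<Longrightarrow> w e * x (head G e) \<le> a * x (tail G e)"
    and a: "0 \<le> a"
    and p: "awalk u p v"
  shows "(\<Prod>e\<leftarrow>p. w e) * x v \<le> a ^ length p * x u"
  using p
proof (induction p arbitrary: u)
  case Nil
  then show ?case by (simp add: awalk_Nil_iff)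
next
  case (Cons e p)
  then have e: "e \<in> arcs G" "u = tail G e" "awalk (head G e) p v"
    by (auto simp: awalk_Cons_iff)
  have "(\<Prod>e\<leftarrow>e # p. w e) * x v = w e * ((\<Prod>e\<leftarrow>p. w e) * x v)"
    by (simp add: mult.assoc)
  also have "\<dots> \<le> w e * (a ^ length p * x (head G e))"
    using Cons.IH[OF e(3)] w[OF e(1)] by (rule mult_left_mono)
  also have "\<dots> = a ^ length p * (w e * x (head G e))"
    by (simp add: ac_simps)
  also have "\<dots> \<le> a ^ length p * (a * x (tail G e))"
    using x[OF e(1)] a by (intro mult_left_mono) auto
  finally show ?case
    using e(2) by (simp add: ac_simps)
qed

text \<open>A closed walk that is not a cycle splits at a repeated vertex into two shorter closed
  walks, and weights multiply.\<close>

lemma closed_awalk_prod_le_1: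
  fixes w :: "'b \<Rightarrow> real"
  assumes w: "\<And>e. e \<in> arcs G \<Longrightarrow> 0 \<le> w e"
    and cyc: "\<And>p. cycle p \<Longrightarrow> (\<Prod>e\<leftarrow>p. w e) \<le> 1"
    and "awalk u p u"
  shows "(\<Prod>e\<leftarrow>p. w e) \<le> 1"
  using assms(3)
proof (induction "length p" arbitrary: p u rule: less_induct)
  case less
  show ?case
  \<comment> \<open>A closed walk lists \<open>u\<close> both first and last, hence the
    \<open>tl\<close>; the empty walk is not a cycle and is covered separately.\<close>
  proof (cases "p = [] \<or> distinct (tl (awalk_verts u p))")
    case True
    with less.prems have "p = [] \<or> cycle p"
      unfolding cycle_def by blast
    with cyc show ?thesis by auto
  next
    case False
    then obtain e es where p: "p = e # es" by (cases p) auto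
    with False less.prems have es: "awalk (head G e) es u" "\<not> distinct (awalk_verts (head G e) es)"
      by (auto simp: awalk_Cons_iff)
    obtain q r s z where qrs: "es = q @ r @ s" "0 < length r"
      "awalk (head G e) q z" "awalk z r z" "awalk z s u"
      using awalk_not_distinct_decomp[OF es] by auto
    \<comment> \<open>The arc \<open>e\<close> stays with the remainder, so \<open>r\<close> is
      shorter than \<open>p\<close>; the remainder is shorter because \<open>r\<close> is
      nonempty.\<close>
    have rest: "awalk u (e # q @ s) u"
      using less.prems p qrs by (simp add: awalk_Cons_iff)
    have "length r < length p" "length (e # q @ s) < length p"
      using p qrs(1,2) by simp_all
    then have "(\<Prod>e\<leftarrow>r. w e) \<le> 1" "(\<Prod>e\<leftarrow>e # q @ s. w e) \<le> 1"
      using less.hyps qrs(4) rest by blast+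
    then have "(\<Prod>e\<leftarrow>r. w e) * (\<Prod>e\<leftarrow>e # q @ s. w e) \<le> 1 * 1"
      using awalk_prod_nonneg[OF w rest] by (intro mult_mono) auto
    then show ?thesis
      using p qrs(1) by (simp add: ac_simps)
  qed
qed

text \<open>Removing a closed subwalk of weight at most 1 does not decrease the weight. The gain is
  finiteness: there are only finitely many paths, so all walk weights have a common bound.\<close>

lemma awalk_prod_le_apath_prod:
  fixes w :: "'b \<Rightarrow> real"
  assumes w: "\<And>e. e \<in> arcs G \<Longrightarrow> 0 \<le> w e"
    and cyc: "\<And>p. cycle p \<Longrightarrow> (\<Prod>e\<leftarrow>p. w e) \<le> 1"
    and "awalk u p v"
  shows "\<exists>q. apath u q v \<and> (\<Prod>e\<leftarrow>p. w e) \<le> (\<Prod>e\<leftarrow>q. w e)"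
  using assms(3)
proof (induction rule: awalk_to_apath_induct)
  case (path p)
  then show ?case by (auto simp: apath_def)
next
  case (decomp p q r s)
  obtain z where qrs: "p = q @ r @ s" "awalk u q z" "awalk z r z" "awalk z s v"
    using decomp by (auto elim: awalk_cyc_decompE)
  then have "awalk u (q @ s) v"
    by (auto intro: awalk_appendI)
  from awalk_prod_nonneg[OF w this] closed_awalk_prod_le_1[OF w cyc qrs(3)]
  have "(\<Prod>e\<leftarrow>r. w e) * (\<Prod>e\<leftarrow>q @ s. w e) \<le> 1 * (\<Prod>e\<leftarrow>q @ s. w e)"
    by (intro mult_right_mono)
  then have "(\<Prod>e\<leftarrow>p. w e) \<le> (\<Prod>e\<leftarrow>q @ s. w e)"
    using qrs(1) by (simp add: ac_simps)
  with decomp show ?case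
    by (meson order_trans)
qed

end

text \<open>Let \<open>x u\<close> be the supremum of the weights of walks from \<open>u\<close>.
  The empty walk gives the bound 1, and prepending \<open>e\<close> to a walk from its head gives a
  walk from its tail, which is the arc inequality.\<close>

lemma (in fin_digraph) exists_potential:
  fixes w :: "'b \<Rightarrow> real"
  assumes w: "\<And>e. e \<in> arcs G \<Longrightarrow> 0 \<le> w e"
    and cyc: "\<And>p. cycle p \<Longrightarrow> (\<Prod>e\<leftarrow>p. w e) \<le> 1"
  obtains x :: "'a \<Rightarrow> real"
    where "\<And>v. v \<in> verts G \<Longrightarrow> 1 \<le> x v"
      and "\<And>e. e \<in> arcs G \<Longrightarrow> w e * x (head G e) \<le> x (tail G e)"
proof
  define W where "W u = {\<Prod>e\<leftarrow>p. w e | p v. awalk u p v}" for u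
  let ?x = "\<lambda>u. Sup (W u)"
  let ?P = "(\<lambda>(u, p, v). \<Prod>e\<leftarrow>p. w e) ` {(u, p, v). apath u p v}"
  have "finite ?P"
    using apaths_finite_triple by (rule finite_imageI)
  have bdd: "bdd_above (W u)" for u
  proof (rule bdd_aboveI)
    fix y assume "y \<in> W u"
    then obtain p v where "awalk u p v" "y = (\<Prod>e\<leftarrow>p. w e)"
      by (auto simp: W_def)
    with awalk_prod_le_apath_prod[OF w cyc] obtain q where "apath u q v" "y \<le> (\<Prod>e\<leftarrow>q. w e)"
      by blast
    moreover from this have "(\<Prod>e\<leftarrow>q. w e) \<in> ?P"
      by force
    ultimately show "y \<le> Max ?P"
      using \<open>finite ?P\<close> by (meson Max_ge order_trans)
  qed
  have one: "1 \<in> W u" if "u \<in> verts G" for u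
    using that unfolding W_def by (intro CollectI exI[of _ "[]"] exI[of _ u]) (simp add: awalk_Nil_iff)
  show "1 \<le> ?x v" if "v \<in> verts G" for v
    using one[OF that] bdd by (rule cSup_upper)
  show "w e * ?x (head G e) \<le> ?x (tail G e)" if e: "e \<in> arcs G" for e
  proof (cases "w e = 0")
    case True
    from one[of "tail G e"] e have "1 \<le> ?x (tail G e)"
      using bdd by (intro cSup_upper) auto
    with True show ?thesis by simp
  next
    case False
    with w[OF e] have pos: "0 < w e" by simp
    have "?x (head G e) \<le> ?x (tail G e) / w e"
    proof (rule cSup_least)
      show "W (head G e) \<noteq> {}"
        using one[of "head G e"] e by auto
      fix y assume "y \<in> W (head G e)"
      then obtain p v where "awalk (head G e) p v" "y = (\<Prod>e\<leftarrow>p. w e)"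
        by (auto simp: W_def)
      with e have "awalk (tail G e) (e # p) v" "w e * y = (\<Prod>e\<leftarrow>e # p. w e)"
        by (simp_all add: awalk_Cons_iff)
      then have "w e * y \<in> W (tail G e)"
        unfolding W_def by blast
      then have "w e * y \<le> ?x (tail G e)"
        using bdd by (rule cSup_upper)
      then show "y \<le> ?x (tail G e) / w e"
        using pos by (simp add: pos_le_divide_eq mult.commute)
    qed
    then show ?thesis
      using pos by (simp add: pos_le_divide_eq mult.commute)
  qed
qed

section \<open>The fixed point\<close>

text \<open>A Knaster-Tarski argument for the monotone map taking \<open>y\<close> to the minimum of
  \<open>z\<close> and \<open>B y\<close>. At a fixed point \<open>x\<close>, the term
  \<open>b i j * x j\<close> is at most \<open>b i j * z j \<le> z i\<close> and at most the whole
  sum, whose terms are nonnegative, hence at most \<open>x i\<close>.\<close>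

lemma exists_max_le_sum_vector:
  fixes b :: "'i \<Rightarrow> 'i \<Rightarrow> real"
  assumes I: "finite I"
    and b: "\<And>i j. i \<in> I \<Longrightarrow> j \<in> I \<Longrightarrow> 0 \<le> b i j"
    and z: "\<And>i j. i \<in> I \<Longrightarrow> j \<in> I \<Longrightarrow> b i j * z j \<le> z i"
    and u: "\<And>i. i \<in> I \<Longrightarrow> 0 \<le> u i" "\<And>i. i \<in> I \<Longrightarrow> u i \<le> z i"
      "\<And>i. i \<in> I \<Longrightarrow> u i \<le> (\<Sum>j\<in>I. b i j * u j)"
  obtains x where "\<And>i. i \<in> I \<Longrightarrow> u i \<le> x i"
    and "\<And>i j. i \<in> I \<Longrightarrow> j \<in> I \<Longrightarrow> b i j * x j \<le> x i"
    and "\<And>i. i \<in> I \<Longrightarrow> x i \<le> (\<Sum>j\<in>I. b i j * x j)"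
proof
  \<comment> \<open>The post-fixed points above \<open>u\<close>. Nothing is constrained outside
    \<open>I\<close>, so upper bounds on the supremum \<open>x\<close> are claimed on
    \<open>I\<close> only.\<close>
  define P where
    "P = {y. \<forall>i\<in>I. u i \<le> y i \<and> y i \<le> z i \<and> y i \<le> (\<Sum>j\<in>I. b i j * y j)}"
  define x where "x i = (SUP y\<in>P. y i)" for i
  have uP: "u \<in> P"
    using u by (auto simp: P_def)
  have upper: "y i \<le> x i" if "y \<in> P" "i \<in> I" for y i
    unfolding x_def using that by (intro cSUP_upper bdd_aboveI[of _ "z i"]) (auto simp: P_def)
  have least: "x i \<le> c" if "\<And>y. y \<in> P \<Longrightarrow> y i \<le> c" for i c
    unfolding x_def using that uP by (intro cSUP_least) auto
  have sum_mono_b: "(\<Sum>j\<in>I. b i j * y j) \<le> (\<Sum>j\<in>I. b i j * y' j)"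
    if "i \<in> I" "\<And>j. j \<in> I \<Longrightarrow> y j \<le> y' j" for i and y y' :: "'i \<Rightarrow> real"
    using that b by (intro sum_mono mult_left_mono) auto
  show ux: "u i \<le> x i" if "i \<in> I" for i
    using upper[OF uP that] .
  have xz: "x i \<le> z i" if "i \<in> I" for i
    using that by (intro least) (auto simp: P_def)
  show xs: "x i \<le> (\<Sum>j\<in>I. b i j * x j)" if "i \<in> I" for i
  proof (rule least)
    fix y assume "y \<in> P"
    then have "y i \<le> (\<Sum>j\<in>I. b i j * y j)"
      using that by (auto simp: P_def)
    also have "\<dots> \<le> (\<Sum>j\<in>I. b i j * x j)"
      using that \<open>y \<in> P\<close> upper by (intro sum_mono_b)
    finally show "y i \<le> (\<Sum>j\<in>I. b i j * x j)" .
  qed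
  \<comment> \<open>\<open>t\<close> is the image of \<open>x\<close> under the map. From
    \<open>x \<le> t\<close> and monotonicity, \<open>t\<close> lies in \<open>P\<close> again, so
    \<open>t \<le> x\<close> by the choice of \<open>x\<close>.\<close>
  define t where "t i = min (z i) (\<Sum>j\<in>I. b i j * x j)" for i
  have xt: "x i \<le> t i" if "i \<in> I" for i
    using xz xs that by (simp add: t_def)
  have "t i \<le> (\<Sum>j\<in>I. b i j * t j)" if "i \<in> I" for i
    using sum_mono_b[OF that xt] by (simp add: t_def min_le_iff_disj)
  then have "t \<in> P"
    using ux xt by (auto simp: P_def t_def intro: order_trans)
  then have tx: "t i \<le> x i" if "i \<in> I" for i
    using upper that by blast
  show "b i j * x j \<le> x i" if ij: "i \<in> I" "j \<in> I" for i j
  proof -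
    have "b i j * x j \<le> b i j * z j"
      using b[OF ij] xz[OF ij(2)] by (intro mult_left_mono)
    also have "\<dots> \<le> z i"
      using z[OF ij] .
    finally have "b i j * x j \<le> z i" .
    moreover have "b i j * x j \<le> (\<Sum>j\<in>I. b i j * x j)"
    proof (rule member_le_sum[OF ij(2) _ I])
      fix k assume "k \<in> I - {j}"
      then show "0 \<le> b i k * x k"
        using b[of i k] u(1)[of k] ux[of k] ij by (intro mult_nonneg_nonneg) auto
    qed
    ultimately show ?thesis
      using tx[OF ij(1)] by (simp add: t_def)
  qed
qed

section \<open>Spectral radius of a nonnegative matrix\<close>

text \<open>Take moduli in \<open>A v = l v\<close> with \<open>norm l\<close> maximal and apply the
  triangle inequality. Some entries may vanish; irreducibility is brought in only later to obtain
  positivity.\<close>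

lemma spectral_radius_subeigenvector:
  assumes A: "A \<in> carrier_mat n n" and n: "0 < n" and nonneg: "nonneg_real_mat A"
  obtains u k where "k < n" "0 < u k" "\<And>i. (0 :: real) \<le> u i"
    and "\<And>i. i < n \<Longrightarrow> real_spectral_radius A * u i \<le> (\<Sum>j<n. A $$ (i, j) * u j)"
proof -
  let ?A = "map_mat complex_of_real A"
  have cA: "?A \<in> carrier_mat n n"
    using A by simp
  obtain l v where l: "norm l = real_spectral_radius A" and ev: "eigenvector ?A v l"
    using spectral_radius_mem_max(1)[OF cA n]
    by (auto simp: real_spectral_radius_def spectrum_def eigenvalue_def)
  then have v: "v \<in> carrier_vec n" "v \<noteq> 0\<^sub>v n" and Av: "?A *\<^sub>v v = l \<cdot>\<^sub>v v"
    using cA by (auto simp: eigenvector_def)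
  obtain k where k: "k < n" "v $ k \<noteq> 0"
    using v by (auto simp: vec_eq_iff)
  show thesis
  proof (rule that[of k "\<lambda>i. norm (v $ i)"])
    fix i assume i: "i < n"
    have "real_spectral_radius A * norm (v $ i) = norm ((?A *\<^sub>v v) $ i)"
      using Av l i v by (simp add: norm_mult)
    also have "(?A *\<^sub>v v) $ i = (\<Sum>j<n. ?A $$ (i, j) * v $ j)"
      using i A v by (simp add: scalar_prod_def atLeast0LessThan)
    also have "norm \<dots> \<le> (\<Sum>j<n. norm (?A $$ (i, j) * v $ j))"
      by (rule norm_sum)
    also have "\<dots> = (\<Sum>j<n. A $$ (i, j) * norm (v $ j))"
      using nonneg A i by (intro sum.cong) (auto simp: norm_mult nonneg_real_mat_def)
    finally show "real_spectral_radius A * norm (v $ i) \<le> (\<Sum>j<n. A $$ (i, j) * norm (v $ j))" .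
  qed (use k in auto)
qed

section \<open>Lower bounds for the spectral radius from the growth of matrix powers\<close>

lemma spectral_radius_smult_less_1:
  assumes A: "A \<in> carrier_mat n n" and n: "0 < n" and b: "spectral_radius A < b"
  shows "spectral_radius (complex_of_real (1 / b) \<cdot>\<^sub>m A) < 1"
proof -
  have cB: "complex_of_real (1 / b) \<cdot>\<^sub>m A \<in> carrier_mat n n"
    using A by simp
  obtain l0 where "l0 \<in> spectrum A" "norm l0 = spectral_radius A"
    using spectral_radius_mem_max(1)[OF A n] by auto
  with b have b0: "0 < b"
    using norm_ge_zero[of l0] by linarith
  obtain l v where l: "norm l = spectral_radius (complex_of_real (1 / b) \<cdot>\<^sub>m A)"
    and ev: "eigenvector (complex_of_real (1 / b) \<cdot>\<^sub>m A) v l"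
    using spectral_radius_mem_max(1)[OF cB n] by (auto simp: spectrum_def eigenvalue_def)
  have v: "v \<in> carrier_vec n" "v \<noteq> 0\<^sub>v n"
    and Bv: "(complex_of_real (1 / b) \<cdot>\<^sub>m A) *\<^sub>v v = l \<cdot>\<^sub>v v"
    using ev cB by (auto simp: eigenvector_def)
  \<comment> \<open>Undoing the scaling turns an eigenvalue \<open>l\<close> of \<open>A / b\<close>
    into the eigenvalue \<open>b * l\<close> of \<open>A\<close>.\<close>
  have "A *\<^sub>v v = (complex_of_real b * l) \<cdot>\<^sub>v v"
  proof (rule eq_vecI)
    fix i assume "i < dim_vec ((complex_of_real b * l) \<cdot>\<^sub>v v)"
    with v have i: "i < n" by simp
    from Bv have "((complex_of_real (1 / b) \<cdot>\<^sub>m A) *\<^sub>v v) $ i = (l \<cdot>\<^sub>v v) $ i"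
      by simp
    with i v A have "complex_of_real (1 / b) * (A *\<^sub>v v) $ i = l * v $ i"
      by simp
    then show "(A *\<^sub>v v) $ i = ((complex_of_real b * l) \<cdot>\<^sub>v v) $ i"
      using i v b0 by (simp add: field_simps)
  qed (use A v in auto)
  then have "complex_of_real b * l \<in> spectrum A"
    using v A by (auto simp: spectrum_def eigenvalue_def eigenvector_def)
  then have "norm (complex_of_real b * l) \<le> spectral_radius A"
    by (intro spectral_radius_mem_max(2)[OF A n] imageI)
  with b0 have "b * norm l \<le> spectral_radius A"
    by (simp add: norm_mult)
  also note b
  finally have "norm l < 1"
    using b0 by simp
  with l show ?thesis by simp
qed

lemma nonneg_pow_mat:
  fixes A :: "real mat"
  assumes A: "A \<in> carrier_mat n n"
    and nonneg: "\<And>i j. i < n \<Longrightarrow> j < n \<Longrightarrow> 0 \<le> A $$ (i, j)"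
    and ij: "i < n" "j < n"
  shows "0 \<le> (A ^\<^sub>m k) $$ (i, j)"
  using ij
proof (induction k arbitrary: i j)
  case 0
  then show ?case using A by simp
next
  case (Suc k)
  have "A ^\<^sub>m k \<in> carrier_mat n n"
    using A by simp
  with Suc A nonneg show ?case
    by (auto simp: scalar_prod_def intro!: sum_nonneg mult_nonneg_nonneg)
qed

text \<open>Applying the nonnegative matrix \<open>A ^\<^sub>m k\<close> to
  \<open>t x \<le> A x\<close> preserves the inequality, which gives the induction step.\<close>

lemma pow_mat_growth:
  fixes A :: "real mat"
  assumes A: "A \<in> carrier_mat n n"
    and nonneg: "\<And>i j. i < n \<Longrightarrow> j < n \<Longrightarrow> 0 \<le> A $$ (i, j)"
    and t: "0 \<le> t"
    and x: "\<And>i. i < n \<Longrightarrow> t * x i \<le> (\<Sum>j<n. A $$ (i, j) * x j)"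
    and i: "i < n"
  shows "t ^ k * x i \<le> (\<Sum>j<n. (A ^\<^sub>m k) $$ (i, j) * x j)"
proof (induction k)
  case 0
  have "(\<Sum>j<n. (A ^\<^sub>m 0) $$ (i, j) * x j) = (\<Sum>j<n. if i = j then x j else 0)"
    using A i by (intro sum.cong) auto
  with i show ?case by simp
next
  case (Suc k)
  have Ak: "A ^\<^sub>m k \<in> carrier_mat n n"
    using A by simp
  have "t ^ Suc k * x i = t * (t ^ k * x i)"
    by simp
  also have "\<dots> \<le> t * (\<Sum>j<n. (A ^\<^sub>m k) $$ (i, j) * x j)"
    using Suc t by (rule mult_left_mono)
  also have "\<dots> = (\<Sum>j<n. (A ^\<^sub>m k) $$ (i, j) * (t * x j))"
    by (simp add: sum_distrib_left ac_simps)
  also have "\<dots> \<le> (\<Sum>j<n. (A ^\<^sub>m k) $$ (i, j) * (\<Sum>l<n. A $$ (j, l) * x l))"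
    using x nonneg_pow_mat[OF A nonneg] i by (intro sum_mono mult_left_mono) auto
  also have "\<dots> = (\<Sum>j<n. \<Sum>l<n. (A ^\<^sub>m k) $$ (i, j) * A $$ (j, l) * x l)"
    by (simp add: sum_distrib_left mult.assoc)
  also have "\<dots> = (\<Sum>l<n. \<Sum>j<n. (A ^\<^sub>m k) $$ (i, j) * A $$ (j, l) * x l)"
    by (rule sum.swap)
  also have "\<dots> = (\<Sum>l<n. (A ^\<^sub>m Suc k) $$ (i, l) * x l)"
    using A Ak i
    by (intro sum.cong) (auto simp: scalar_prod_def sum_distrib_right atLeast0LessThan)
  finally show ?case .
qed

text \<open>The lower bound of Collatz-Wielandt type, for a vector of which only one entry is known
  to be positive.\<close>

lemma spectral_radius_ge_subeigenvalue:
  assumes A: "A \<in> carrier_mat n n" and nonneg: "nonneg_real_mat A"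
    and x: "\<And>i. i < n \<Longrightarrow> a * x i \<le> (\<Sum>j<n. A $$ (i, j) * x j)"
    and k: "k < n" "0 < x k"
  shows "a \<le> real_spectral_radius A"
proof (rule ccontr)
  let ?A = "map_mat complex_of_real A"
  assume "\<not> ?thesis"
  \<comment> \<open>With \<open>b\<close> strictly in between, \<open>A / b\<close> has spectral
    radius below 1 while \<open>a / b\<close> exceeds 1.\<close>
  then obtain b where b: "real_spectral_radius A < b" "b < a"
    using dense not_le by blast
  have cA: "?A \<in> carrier_mat n n" and n: "0 < n"
    using A k by auto
  obtain l :: complex where "norm l = real_spectral_radius A"
    using spectral_radius_mem_max(1)[OF cA n] by (auto simp: real_spectral_radius_def)
  with b have b0: "0 < b"
    using norm_ge_zero[of l] by linarith
  define B where "B = (1 / b) \<cdot>\<^sub>m A"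
  have B: "B \<in> carrier_mat n n"
    using A by (simp add: B_def)
  have B_nonneg: "0 \<le> B $$ (i, j)" if "i < n" "j < n" for i j
    using that A nonneg b0 by (auto simp: B_def nonneg_real_mat_def)
  have cB: "map_mat complex_of_real B = complex_of_real (1 / b) \<cdot>\<^sub>m ?A"
    by (rule eq_matI) (auto simp: B_def)
  have "spectral_radius (map_mat complex_of_real B) < 1"
    unfolding cB using b(1) by (intro spectral_radius_smult_less_1[OF cA n]) (simp add: real_spectral_radius_def)
  \<comment> \<open>The Jordan normal form bounds the entries of all powers by one constant.\<close>
  then obtain c where c: "\<And>m. norm_bound (map_mat complex_of_real B ^\<^sub>m m) c"
    using spectral_radius_jnf_norm_bound_less_1_upper_triangular[of "map_mat complex_of_real B" n] B
    by auto
  have Bm: "\<bar>(B ^\<^sub>m m) $$ (i, j)\<bar> \<le> c" if "i < n" "j < n" for m i j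
  proof -
    have Bmc: "B ^\<^sub>m m \<in> carrier_mat n n"
      using B by simp
    have "norm_bound (map_mat complex_of_real (B ^\<^sub>m m)) c"
      using c[of m] by (simp add: of_real_hom.mat_hom_pow[OF B])
    then have "norm (map_mat complex_of_real (B ^\<^sub>m m) $$ (i, j)) \<le> c"
      using that carrier_matD[OF Bmc] unfolding norm_bound_def by (metis index_map_mat(2,3))
    with carrier_matD[OF Bmc] that show ?thesis
      by simp
  qed
  have "(a / b) ^ m * x k \<le> c * (\<Sum>j<n. \<bar>x j\<bar>)" for m
  proof -
    have "a / b * x i \<le> (\<Sum>j<n. B $$ (i, j) * x j)" if "i < n" for i
    proof -
      have "(\<Sum>j<n. B $$ (i, j) * x j) = (\<Sum>j<n. A $$ (i, j) * x j) / b"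
        using A that by (simp add: B_def sum_divide_distrib)
      with x[OF that] b0 show ?thesis
        by (simp add: divide_right_mono)
    qed
    then have "(a / b) ^ m * x k \<le> (\<Sum>j<n. (B ^\<^sub>m m) $$ (k, j) * x j)"
      using b b0 k by (intro pow_mat_growth[OF B B_nonneg]) auto
    \<comment> \<open>Entries of \<open>x\<close> other than \<open>x k\<close> may be negative,
      hence the absolute values.\<close>
    also have "\<dots> \<le> (\<Sum>j<n. \<bar>(B ^\<^sub>m m) $$ (k, j)\<bar> * \<bar>x j\<bar>)"
      by (intro sum_mono) (metis abs_ge_self abs_mult)
    also have "\<dots> \<le> (\<Sum>j<n. c * \<bar>x j\<bar>)"
      using Bm k by (intro sum_mono mult_right_mono) auto
    finally show ?thesis
      by (simp add: sum_distrib_left)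
  qed
  moreover obtain m where "c * (\<Sum>j<n. \<bar>x j\<bar>) / x k < (a / b) ^ m"
    using real_arch_pow[of "a / b"] b b0 by auto
  ultimately show False
    using k by (metis not_le pos_divide_less_eq)
qed

section \<open>Sum visualizations\<close>

lemma fin_digraph_mat_digraph:
  assumes "A \<in> carrier_mat n n"
  shows "fin_digraph (mat_digraph A)"
proof
  have "arcs (mat_digraph A) \<subseteq> {0..<dim_row A} \<times> {0..<dim_col A}"
    by (auto simp: mat_digraph_def)
  then show "finite (arcs (mat_digraph A))"
    by (rule finite_subset) simp
qed (use assms in \<open>auto simp: mat_digraph_def\<close>)

text \<open>The entries of the scaled matrix are \<open>A $$ (i, j) * x j / x i\<close>; multiplying
  by \<open>x i\<close> gives the division-free form used in both inclusions.\<close>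

lemma sum_visualizing_vector_iff:
  assumes A: "A \<in> carrier_mat n n"
  shows "sum_visualizing_vector a A (vec n x) \<longleftrightarrow>
     0 < a \<and> (\<forall>i<n. 0 < x i) \<and> (\<forall>i<n. \<forall>j<n. A $$ (i, j) * x j \<le> a * x i) \<and>
     (\<forall>i<n. a * x i \<le> (\<Sum>j<n. A $$ (i, j) * x j))"
proof -
  have D: "diag_similarity A (vec n x) $$ (i, j) = A $$ (i, j) * x j / x i" if "i < n" "j < n" for i j
    using diag_similarity_index[OF A _ that, of "vec n x"] that by (simp add: field_simps)
  have "(\<Sum>j<n. diag_similarity A (vec n x) $$ (i, j)) = (\<Sum>j<n. A $$ (i, j) * x j) / x i"
    if "i < n" for i
    using that by (simp add: D sum_divide_distrib)
  then show ?thesis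
    using A D unfolding sum_visualizing_vector_def
    by (auto simp: pos_divide_le_eq pos_le_divide_eq)
qed

lemma sum_visualization_levels_iff:
  assumes A: "A \<in> carrier_mat n n"
  shows "a \<in> sum_visualization_levels A \<longleftrightarrow>
    0 < a \<and> (\<exists>x. (\<forall>i<n. 0 < x i) \<and> (\<forall>i<n. \<forall>j<n. A $$ (i, j) * x j \<le> a * x i) \<and>
     (\<forall>i<n. a * x i \<le> (\<Sum>j<n. A $$ (i, j) * x j)))"
proof -
  have "a \<in> sum_visualization_levels A \<longleftrightarrow> (\<exists>x. sum_visualizing_vector a A x)"
    by (auto simp: sum_visualization_levels_def sum_visualization_def sum_visualizing_vector_def)
  also have "\<dots> \<longleftrightarrow> (\<exists>x. sum_visualizing_vector a A (vec n x))"
  proof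
    assume "\<exists>x. sum_visualizing_vector a A x"
    then obtain x where x: "sum_visualizing_vector a A x" ..
    with A have "x = vec n (\<lambda>i. x $ i)"
      by (auto simp: sum_visualizing_vector_def)
    with x show "\<exists>x. sum_visualizing_vector a A (vec n x)"
      by metis
  qed auto
  finally show ?thesis
    by (auto simp: sum_visualizing_vector_iff[OF A])
qed

theorem theorem2p8:
  fixes A :: "real mat" and n :: nat
  assumes "A \<in> carrier_mat n n"
    and "nonneg_real_mat A"
    and "irreducible_real_mat A"
    and "\<exists>p. pre_digraph.cycle (mat_digraph A) p"
  shows "sum_visualization_levels A = {max_cycle_mean A .. real_spectral_radius A}"
proof -
  let ?G = "mat_digraph A"
  interpret G: fin_digraph ?G
    using assms(1) by (rule fin_digraph_mat_digraph)
  have G [simp]: "verts ?G = {0..<n}" "tail ?G = fst" "head ?G = snd"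
    using assms(1) by (auto simp: mat_digraph_def)
  have arcs: "e \<in> arcs ?G \<longleftrightarrow> fst e < n \<and> snd e < n \<and> A $$ e \<noteq> 0" for e
    using assms(1) by (cases e) (auto simp: mat_digraph_def)
  have nonneg: "0 \<le> A $$ (i, j)" if "i < n" "j < n" for i j
    using assms(1,2) that by (auto simp: nonneg_real_mat_def)
  then have arc_pos: "0 < A $$ e" if "e \<in> arcs ?G" for e
    using that by (cases e) (force simp: arcs less_le)
  have n: "0 < n"
    using assms(3) by (auto simp: irreducible_real_mat_def strongly_connected_def)
  have mean_pos: "0 < cycle_geometric_mean A p" if "G.cycle p" for p
    using that G.awalk_prod_pos[of "\<lambda>e. A $$ e", OF arc_pos]
    by (auto simp: cycle_geometric_mean_def G.cycle_def)
  have mean_le_iff: "cycle_geometric_mean A p \<le> a \<longleftrightarrow> (\<Prod>e\<leftarrow>p. A $$ e) \<le> a ^ length p"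
    if "G.cycle p" "0 \<le> a" for p a
  proof -
    \<comment> \<open>\<open>root 0\<close> is constantly 0, so cancelling root against power needs
      a nonempty cycle.\<close>
    have "0 < length p"
      using that by (auto simp: G.cycle_def)
    with that(2) show ?thesis
      unfolding cycle_geometric_mean_def
      by (metis real_root_le_iff real_root_power_cancel)
  qed
  have max_le_iff: "max_cycle_mean A \<le> a \<longleftrightarrow> (\<forall>p. G.cycle p \<longrightarrow> cycle_geometric_mean A p \<le> a)" for a
    using assms(4) finite_mat_cycles[OF assms(1)]
    by (subst max_cycle_mean_def, subst Max_le_iff) (auto simp: mat_cycles_def)
  show ?thesis
  proof (intro equalityI subsetI)
    fix a assume "a \<in> sum_visualization_levels A"
    then obtain x where a: "0 < a" and x: "\<And>i. i < n \<Longrightarrow> 0 < x i"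
      and le: "\<And>i j. i < n \<Longrightarrow> j < n \<Longrightarrow> A $$ (i, j) * x j \<le> a * x i"
      and ge: "\<And>i. i < n \<Longrightarrow> a * x i \<le> (\<Sum>j<n. A $$ (i, j) * x j)"
      by (auto simp: sum_visualization_levels_iff[OF assms(1)])
    have "cycle_geometric_mean A p \<le> a" if p: "G.cycle p" for p
    proof -
      obtain u where u: "G.awalk u p u"
        using p by (auto simp: G.cycle_def)
      \<comment> \<open>The walk is closed, so the same positive factor \<open>x u\<close> stands on
        both sides and cancels.\<close>
      have "(\<Prod>e\<leftarrow>p. A $$ e) * x u \<le> a ^ length p * x u"
        by (rule G.awalk_prod_le_potential[OF _ _ _ u])
          (use a le arc_pos in \<open>auto simp: arcs less_imp_le\<close>)
      moreover have "0 < x u"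
        using x G.awalk_hd_in_verts[OF u] by simp
      ultimately show ?thesis
        using a p by (simp add: mean_le_iff)
    qed
    \<comment> \<open>All entries of \<open>x\<close> are positive, so index 0 serves as the
      positive one.\<close>
    moreover have "a \<le> real_spectral_radius A"
      using spectral_radius_ge_subeigenvalue[OF assms(1,2) ge n x[OF n]] by simp
    ultimately show "a \<in> {max_cycle_mean A..real_spectral_radius A}"
      by (simp add: max_le_iff)
  next
    fix a assume "a \<in> {max_cycle_mean A..real_spectral_radius A}"
    then have mean_le: "\<And>p. G.cycle p \<Longrightarrow> cycle_geometric_mean A p \<le> a"
      and a_le: "a \<le> real_spectral_radius A"
      by (auto simp: max_le_iff)
    \<comment> \<open>Some cycle exists, and its mean is positive and at most
      \<open>a\<close>.\<close>
    have a: "0 < a"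
      using assms(4) mean_pos mean_le by (meson less_le_trans)
    have arc_nonneg: "0 \<le> A $$ e / a" if "e \<in> arcs ?G" for e
      using arc_pos[OF that] a by simp
    have "(\<Prod>e\<leftarrow>p. A $$ e / a) \<le> 1" if p: "G.cycle p" for p
    proof -
      have "(\<Prod>e\<leftarrow>p. A $$ e / a) = (\<Prod>e\<leftarrow>p. A $$ e) / a ^ length p"
        by (induction p) auto
      with mean_le[OF p] a show ?thesis
        by (simp add: mean_le_iff[OF p])
    qed
    then obtain y where y: "\<And>i. i < n \<Longrightarrow> 1 \<le> y i"
      and y_arc: "\<And>e. e \<in> arcs ?G \<Longrightarrow> A $$ e / a * y (snd e) \<le> y (fst e)"
      using G.exists_potential[of "\<lambda>e. A $$ e / a", OF arc_nonneg] by auto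
    \<comment> \<open>Zero entries carry no arc; there the claim reduces to
      \<open>0 \<le> y i\<close>.\<close>
    have y_le: "A $$ (i, j) / a * y j \<le> y i" if "i < n" "j < n" for i j
      using y_arc[of "(i, j)"] y[of i] that by (cases "A $$ (i, j) = 0") (auto simp: arcs)
    obtain u k where k: "k < n" "0 < u k" and u: "\<And>i. (0 :: real) \<le> u i"
      and Au: "\<And>i. i < n \<Longrightarrow> real_spectral_radius A * u i \<le> (\<Sum>j<n. A $$ (i, j) * u j)"
      using spectral_radius_subeigenvector[OF assms(1) n assms(2)] by metis
    \<comment> \<open>Instead of shrinking \<open>u\<close>, the potential is enlarged:
      \<open>u i \<le> s \<le> s * y i\<close> since \<open>y i \<ge> 1\<close>, and scaling by
      \<open>s\<close> preserves the potential inequality.\<close>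
    define s where "s = (\<Sum>j<n. u j)"
    have u_le_s: "u i \<le> s" if "i < n" for i
      unfolding s_def using that u by (intro member_le_sum) auto
    obtain x where ux: "\<And>i. i < n \<Longrightarrow> u i \<le> x i"
      and le: "\<And>i j. i < n \<Longrightarrow> j < n \<Longrightarrow> A $$ (i, j) / a * x j \<le> x i"
      and ge: "\<And>i. i < n \<Longrightarrow> x i \<le> (\<Sum>j<n. A $$ (i, j) / a * x j)"
    proof (rule exists_max_le_sum_vector[of "{..<n}" "\<lambda>i j. A $$ (i, j) / a" "\<lambda>i. s * y i" u])
      have s: "0 \<le> s"
        using u by (simp add: s_def sum_nonneg)
      fix i assume i: "i \<in> {..<n}"
      have "s * 1 \<le> s * y i"
        using y i s by (intro mult_left_mono) auto
      with u_le_s i show "u i \<le> s * y i"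
        by force
      \<comment> \<open>This is where the upper end of the interval enters.\<close>
      have "a * u i \<le> real_spectral_radius A * u i"
        using a_le u by (rule mult_right_mono)
      also have "\<dots> \<le> (\<Sum>j<n. A $$ (i, j) * u j)"
        using Au i by simp
      finally show "u i \<le> (\<Sum>j\<in>{..<n}. A $$ (i, j) / a * u j)"
        using a by (simp add: pos_le_divide_eq mult.commute flip: sum_divide_distrib)
      fix j assume j: "j \<in> {..<n}"
      have "s * (A $$ (i, j) / a * y j) \<le> s * y i"
        using y_le i j s by (intro mult_left_mono) auto
      then show "A $$ (i, j) / a * (s * y j) \<le> s * y i"
        by (simp add: ac_simps)
    qed (use a nonneg u that in auto)
    \<comment> \<open>Positivity is known at \<open>k\<close> only. A walk from \<open>i\<close> to
      \<open>k\<close> has positive weight, and the potential inequality for \<open>x\<close> with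
      factor 1 transfers positivity to \<open>i\<close>.\<close>
    have pos: "0 < x i" if i: "i < n" for i
    proof -
      have "i \<in> verts ?G" "k \<in> verts ?G"
        using i k(1) by simp_all
      with assms(3) obtain p where p: "G.awalk i p k"
        unfolding irreducible_real_mat_def strongly_connected_def G.reachable_awalk by blast
      have "0 < (\<Prod>e\<leftarrow>p. A $$ e / a)"
        by (rule G.awalk_prod_pos[OF _ p]) (use arc_pos a in auto)
      moreover have "0 < x k"
        using ux[OF k(1)] k(2) by simp
      moreover have "(\<Prod>e\<leftarrow>p. A $$ e / a) * x k \<le> 1 ^ length p * x i"
        by (rule G.awalk_prod_le_potential[OF arc_nonneg _ _ p]) (use le in \<open>auto simp: arcs\<close>)
      ultimately show ?thesis
        by (metis less_le_trans mult_1 mult_pos_pos power_one)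
    qed
    have "A $$ (i, j) * x j \<le> a * x i" if "i < n" "j < n" for i j
      using le[OF that] a by (simp add: pos_divide_le_eq mult.commute)
    moreover have "a * x i \<le> (\<Sum>j<n. A $$ (i, j) * x j)" if "i < n" for i
      using ge[OF that] a by (simp add: pos_le_divide_eq mult.commute flip: sum_divide_distrib)
    ultimately show "a \<in> sum_visualization_levels A"
      using a pos by (auto simp: sum_visualization_levels_iff[OF assms(1)])
  qed
qed

end
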